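(* Let $G=(V,E)$ be a graph and let $v_1,v_2,\dots$ be a permutation (enumeration) of the vertices $V$ such that, for some $\alpha\ge 1$, $\beta\ge 0$ and all $N\in\mathbb{N}$, $$\#\,\partial_E(\{v_1,\dots,v_N\})\le \beta+\alpha\inf_{A\subseteq V,\ \#A=N}\#\,\partial_E(A).$$ Then for every $f:V\to\mathbb{R}_{\ge 0}$ the associated rearrangement $f^*$ satisfies $$\|\nabla f^*\|_{L^1}\le \alpha\,\|\nabla f\|_{L^1}+\beta\,\|f\|_{L^\infty}.$$
   Context: For $A\subseteq V$, the edge boundary is $\partial_E(A)=\{e\in E: e \text{ joins a vertex of } A \text{ to a vertex of } V\setminus A\}$. For $g:V\to\mathbb{R}$, $\|\nabla g\|_{L^1}=\sum_{(v,w)\in E}|g(v)-g(w)|$ (each edge counted once) and $\|g\|_{L^\infty}=\sup_{v\in V}|g(v)|$. Given the enumeration $v_1,v_2,\dots$ of $V$, the associated rearrangement of a nonnegative function $f$ is $f^*$ defined by $f^*(v_k)=$ the $k$-th largest value assumed by $f$ (values counted with multiplicity). *)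

theory Defs
  imports "HOL-Analysis.Analysis"
begin

(* Vertices and edges may be infinite in number, and vertices may have infinite degree. Hence
   cardinalities, the L1 norm of the gradient and the supremum norm take values in [0,\<infinity>]. *)

definition simple_graph :: "'a set \<Rightarrow> 'a set set \<Rightarrow> bool" where
  "simple_graph V E \<longleftrightarrow> (\<forall>e\<in>E. e \<subseteq> V \<and> card e = 2)"

definition ecount :: "'b set \<Rightarrow> ennreal" where
  "ecount A = emeasure (count_space UNIV) A"

lemma ecount_finite: "finite A \<Longrightarrow> ecount A = of_nat (card A)"
  and ecount_infinite: "infinite A \<Longrightarrow> ecount A = \<infinity>"
  by (auto simp: ecount_def emeasure_count_space)

definition edge_boundary :: "'a set \<Rightarrow> 'a set set \<Rightarrow> 'a set \<Rightarrow> 'a set set" where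
  "edge_boundary V E A = {e \<in> E. \<exists>x\<in>A. \<exists>y\<in>V - A. e = {x, y}}"

definition edge_diff :: "('a \<Rightarrow> real) \<Rightarrow> 'a set \<Rightarrow> real" where
  "edge_diff g e = (THE d. \<exists>x y. e = {x, y} \<and> d = \<bar>g x - g y\<bar>)"

lemma edge_diff_pair: "edge_diff g {x, y} = \<bar>g x - g y\<bar>"
  unfolding edge_diff_def by (rule the_equality) (auto simp: doubleton_eq_iff abs_minus_commute)

definition grad_L1 :: "'a set set \<Rightarrow> ('a \<Rightarrow> real) \<Rightarrow> ennreal" where
  "grad_L1 E g = (\<Sum>\<^sub>\<infinity>e\<in>E. ennreal (edge_diff g e))"

definition sup_norm :: "'a set \<Rightarrow> ('a \<Rightarrow> real) \<Rightarrow> ennreal" where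
  "sup_norm V g = (SUP x\<in>V. ennreal \<bar>g x\<bar>)"

(* Enumerations start at 1; a finite V is enumerated by 1, ..., card V, an infinite (necessarily
   countable) V by all positive integers. *)

definition positions :: "'a set \<Rightarrow> nat set" where
  "positions V = {k. 1 \<le> k \<and> (finite V \<longrightarrow> k \<le> card V)}"

definition enumerates :: "(nat \<Rightarrow> 'a) \<Rightarrow> 'a set \<Rightarrow> bool" where
  "enumerates v V \<longleftrightarrow> bij_betw v (positions V) V"

(* A value is the k-th largest, counted with multiplicity, if fewer than k vertices carry a larger
   value and at least k vertices carry a value at least as large. *)

definition kth_largest :: "'a set \<Rightarrow> ('a \<Rightarrow> real) \<Rightarrow> nat \<Rightarrow> real \<Rightarrow> bool" where
  "kth_largest V f k y \<longleftrightarrow> y \<in> f ` V \<and>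
     ecount {x \<in> V. f x > y} < of_nat k \<and> of_nat k \<le> ecount {x \<in> V. f x \<ge> y}"

(* The rearrangement is a relation because a function on an infinite V need not assume a k-th
   largest value (for instance 1 - 1/n on the positive integers). It is unique on V whenever it
   exists, and it exists whenever f vanishes at infinity. *)

definition is_rearrangement :: "'a set \<Rightarrow> (nat \<Rightarrow> 'a) \<Rightarrow> ('a \<Rightarrow> real) \<Rightarrow> ('a \<Rightarrow> real) \<Rightarrow> bool" where
  "is_rearrangement V v f f' \<longleftrightarrow> (\<forall>k\<in>positions V. kth_largest V f k (f' (v k)))"

lemma ecount_mono: "A \<subseteq> B \<Longrightarrow> ecount A \<le> ecount B"
  by (simp add: ecount_def emeasure_mono)

lemma of_nat_le_ecount_iff: "of_nat k \<le> ecount A \<longleftrightarrow> infinite A \<or> k \<le> card A"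
  by (cases "finite A") (auto simp: ecount_finite ecount_infinite)

lemma kth_largest_unique:
  assumes "kth_largest V f k y" "kth_largest V f k z"
  shows "y = z"
proof -
  have False if "kth_largest V f k a" "kth_largest V f k b" "a < b" for a b
  proof -
    have "of_nat k \<le> ecount {x \<in> V. f x \<ge> b}"
      using that by (simp add: kth_largest_def)
    also have "\<dots> \<le> ecount {x \<in> V. f x > a}"
      using that by (intro ecount_mono) auto
    also have "\<dots> < of_nat k"
      using that by (simp add: kth_largest_def)
    finally show False by simp
  qed
  then show ?thesis
    using assms by (meson linorder_neqE_linordered_idom)
qed

lemma rearrangement_unique:
  assumes "enumerates v V" "is_rearrangement V v f g" "is_rearrangement V v f h" "x \<in> V"
  shows "g x = h x"
proof -
  obtain k where "k \<in> positions V" "x = v k"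
    using assms by (auto simp: enumerates_def bij_betw_def)
  then show ?thesis
    using assms kth_largest_unique unfolding is_rearrangement_def by metis
qed

lemma kth_largest_exists:
  assumes nonneg: "\<forall>x\<in>V. 0 \<le> f x" and van: "\<forall>t>0. finite {x \<in> V. f x \<ge> t}"
    and k: "k \<in> positions V"
  shows "\<exists>y. kth_largest V f k y"
proof (cases "ecount {x \<in> V. f x > 0} < of_nat k")
  case True
  have V: "of_nat k \<le> ecount V" "{x \<in> V. f x \<ge> 0} = V"
    using k nonneg by (auto simp: positions_def of_nat_le_ecount_iff)
  then have "{x \<in> V. f x > 0} \<noteq> V"
    using True by auto
  then have "0 \<in> f ` V"
    using nonneg by force
  then have "kth_largest V f k 0"
    using True V unfolding kth_largest_def by simp
  then show ?thesis ..
next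
  case False
  then have *: "infinite {x \<in> V. f x > 0} \<or> k \<le> card {x \<in> V. f x > 0}"
    by (simp only: of_nat_le_ecount_iff[symmetric] not_less)
  obtain S where S: "S \<subseteq> {x \<in> V. f x > 0}" "finite S" "card S = k"
    using * by (meson infinite_arbitrarily_large obtain_subset_with_card_n)
  have "S \<noteq> {}"
    using S k by (auto simp: positions_def)
  define t where "t = Min (f ` S)"
  have t: "t \<in> f ` S" "\<forall>x\<in>S. t \<le> f x"
    using S \<open>S \<noteq> {}\<close> by (auto simp: t_def intro!: Min_in)
  have "t > 0"
    using t S by auto
  define B where "B = {x \<in> V. f x \<ge> t}"
  have B: "finite B" "S \<subseteq> B"
    using van \<open>t > 0\<close> t S by (auto simp: B_def)
  define Y where "Y = {y \<in> f ` B. of_nat k \<le> ecount {x \<in> V. f x \<ge> y}}"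
  have "k \<le> card B"
    using B S card_mono by metis
  then have "t \<in> Y"
    using B t by (auto simp: Y_def of_nat_le_ecount_iff B_def[symmetric])
  have "finite Y"
    using B by (simp add: Y_def)
  define y where "y = Max Y"
  have y: "y \<in> Y" "\<forall>z\<in>Y. z \<le> y"
    using \<open>finite Y\<close> \<open>t \<in> Y\<close> by (auto simp: y_def intro!: Max_in)
  have "ecount {x \<in> V. f x > y} < of_nat k"
  proof (rule ccontr)
    define C where "C = {x \<in> V. f x > y}"
    assume "\<not> ecount {x \<in> V. f x > y} < of_nat k"
    then have C: "of_nat k \<le> ecount C"
      by (simp add: C_def not_less)
    have "C \<subseteq> B"
      using y by (auto simp: C_def Y_def B_def)
    then have "finite C"
      using B finite_subset by blast
    with C have "k \<le> card C"
      by (simp add: of_nat_le_ecount_iff)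
    then have "C \<noteq> {}"
      using k by (auto simp: positions_def)
    define z where "z = Min (f ` C)"
    have z: "z \<in> f ` C" "\<forall>x\<in>C. z \<le> f x"
      using \<open>finite C\<close> \<open>C \<noteq> {}\<close> by (auto simp: z_def intro!: Min_in)
    have "C \<subseteq> {x \<in> V. f x \<ge> z}"
      using z by (auto simp: C_def)
    then have "of_nat k \<le> ecount {x \<in> V. f x \<ge> z}"
      using C ecount_mono order_trans by blast
    then have "z \<in> Y"
      using z \<open>C \<subseteq> B\<close> by (auto simp: Y_def)
    moreover have "z > y"
      using z by (auto simp: C_def)
    ultimately show False
      using y by auto
  qed
  moreover have "y \<in> f ` V"
    using y by (auto simp: Y_def B_def)
  ultimately show ?thesis
    using y by (auto simp: kth_largest_def Y_def)
qed

lemma rearrangement_exists: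
  assumes "enumerates v V" "\<forall>x\<in>V. 0 \<le> f x" "\<forall>t>0. finite {x \<in> V. f x \<ge> t}"
  shows "\<exists>f'. is_rearrangement V v f f'"
proof -
  have inj: "inj_on v (positions V)"
    using assms by (simp add: enumerates_def bij_betw_def)
  obtain h where h: "\<And>k. k \<in> positions V \<Longrightarrow> kth_largest V f k (h k)"
    using kth_largest_exists[OF assms(2,3)] by metis
  have "is_rearrangement V v f (h \<circ> inv_into (positions V) v)"
    using inj h by (simp add: is_rearrangement_def)
  then show ?thesis by blast
qed

end

(* The coarea formula writes the L1 norm of the gradient of a nonnegative function as the integral
   over t \<ge> 0 of the number of boundary edges of the superlevel set {f > t}. The superlevel set
   {f* > t} of the rearrangement is the initial segment v_1, ..., v_N with N = #{f > t} (all of V if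
   N is infinite, so its boundary is then empty). Hence the hypothesis, applied to A = {f > t},
   bounds the integrand for f* by \<beta> plus \<alpha> times the one for f, and both vanish for t \<ge> sup f. *)

theory Submission
  imports Defs
begin

section \<open>Sums over edges as integrals\<close>

text \<open>Makes Tonelli applicable to the unordered sum in \<open>grad_L1\<close>. An infinite
  countable set is enumerated by the naturals, where both sides become the same series.\<close>

lemma infsum_ennreal_eq_nn_integral:
  fixes g :: "'b \<Rightarrow> ennreal"
  assumes "countable A"
  shows "(\<Sum>\<^sub>\<infinity>x\<in>A. g x) = (\<integral>\<^sup>+x. g x \<partial>count_space A)"
proof (cases "finite A")
  case True
  then show ?thesis
    by (simp add: nn_integral_count_space_finite)
next
  case False
  have bij: "bij_betw (from_nat_into A) UNIV A"
    using assms False by (rule bij_betw_from_nat_into)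
  have "(\<Sum>\<^sub>\<infinity>x\<in>A. g x) = (\<Sum>\<^sub>\<infinity>n. g (from_nat_into A n))"
    using infsum_reindex_bij_betw[OF bij] by metis
  also have "\<dots> = (\<Sum>n. g (from_nat_into A n))"
    by (intro sums_unique has_sum_imp_sums has_sum_infsum nonneg_summable_on_complete) simp
  also have "\<dots> = (\<integral>\<^sup>+n. g (from_nat_into A n) \<partial>count_space UNIV)"
    by (simp add: nn_integral_count_space_nat)
  also have "\<dots> = (\<integral>\<^sup>+x. g x \<partial>count_space A)"
    by (rule nn_integral_bij_count_space[OF bij])
  finally show ?thesis .
qed

lemma ecount_eq_nn_integral:
  assumes "B \<subseteq> A"
  shows "ecount B = (\<integral>\<^sup>+x. indicator B x \<partial>count_space A)"
proof -
  have "ecount B = emeasure (count_space A) B"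
    using assms by (cases "finite B") (auto simp: ecount_def emeasure_count_space)
  then show ?thesis
    using assms by simp
qed

text \<open>Edges are finite subsets of \<open>V\<close>. Countability makes the counting measure on
  \<open>E\<close> sigma-finite, on which the exchange of integrals in \<open>coarea\<close>
  rests.\<close>

lemma countable_edges:
  assumes "simple_graph V E" "countable V"
  shows "countable E"
proof (rule countable_subset)
  show "E \<subseteq> {A. finite A \<and> A \<subseteq> V}"
    using assms by (auto simp: simple_graph_def intro!: card_ge_0_finite)
  show "countable {A. finite A \<and> A \<subseteq> V}"
    using assms by (intro countable_Collect_finite_subset)
qed

section \<open>Coarea formula\<close>

text \<open>The coarea formula for a single edge: the levels cutting it form a half-open interval
  whose length is its term in the gradient norm.\<close>

lemma edge_boundary_superlevel:
  fixes f :: "'a \<Rightarrow> real"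
  assumes "{x, y} \<in> E" "x \<in> V" "y \<in> V"
  shows "{x, y} \<in> edge_boundary V E {z \<in> V. t < f z} \<longleftrightarrow> min (f x) (f y) \<le> t \<and> t < max (f x) (f y)"
proof -
  have "{x, y} \<in> edge_boundary V E {z \<in> V. t < f z} \<longleftrightarrow>
      t < f x \<and> f y \<le> t \<or> t < f y \<and> f x \<le> t"
  proof -
    have "{x, y} \<in> edge_boundary V E A \<longleftrightarrow> x \<in> A \<and> y \<in> V - A \<or> y \<in> A \<and> x \<in> V - A" for A
      using assms unfolding edge_boundary_def mem_Collect_eq doubleton_eq_iff by blast
    then show ?thesis
      using assms by (auto simp: not_less)
  qed
  then show ?thesis by auto
qed

text \<open>Tonelli on the pairs (e, t) such that level t cuts e: integrating over t first gives the
  gradient norm, summing over e first gives the boundary count.\<close>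

lemma coarea:
  assumes G: "simple_graph V E" and V: "countable V" and nonneg: "\<forall>x\<in>V. 0 \<le> f x"
  shows borel_measurable_ecount_superlevel:
      "(\<lambda>t. ecount (edge_boundary V E {x \<in> V. t < f x}) * indicator {0..} t) \<in> borel_measurable lborel"
    and grad_L1_eq_nn_integral:
      "grad_L1 E f =
        (\<integral>\<^sup>+t. ecount (edge_boundary V E {x \<in> V. t < f x}) * indicator {0..} t \<partial>lborel)"
proof -
  define S where "S e = {t. 0 \<le> t \<and> e \<in> edge_boundary V E {x \<in> V. t < f x}}" for e
  have E: "countable E"
    using G V by (rule countable_edges)
  have S: "S e \<in> sets lborel \<and> emeasure lborel (S e) = ennreal (edge_diff f e)" if "e \<in> E" for e
  proof -
    have "e \<subseteq> V" "card e = 2"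
      using G that by (auto simp: simple_graph_def)
    then obtain x y where e: "e = {x, y}" and xy: "x \<in> V" "y \<in> V"
      by (auto simp: card_2_iff)
    \<comment> \<open>No negative level cuts the edge, so the condition \<open>0 \<le> t\<close> in
      \<open>S\<close> does not truncate the interval.\<close>
    with nonneg have "0 \<le> min (f x) (f y)"
      by simp
    then have "S e = {min (f x) (f y)..<max (f x) (f y)}"
      using xy that e by (auto simp: S_def edge_boundary_superlevel)
    then show ?thesis
      by (simp add: e edge_diff_pair max_def min_def abs_real_def)
  qed
  have integrand: "ecount (edge_boundary V E {x \<in> V. t < f x}) * indicator {0..} t =
      (\<integral>\<^sup>+e. indicator (S e) t \<partial>count_space E)" for t
  proof -
    have "(\<integral>\<^sup>+e. indicator (S e) t \<partial>count_space E) =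
        (\<integral>\<^sup>+e. indicator (edge_boundary V E {x \<in> V. t < f x}) e * indicator {0..} t \<partial>count_space E)"
      by (intro nn_integral_cong) (auto simp: S_def split: split_indicator)
    also have "\<dots> = (\<integral>\<^sup>+e. indicator (edge_boundary V E {x \<in> V. t < f x}) e \<partial>count_space E) *
        indicator {0..} t"
      by (rule nn_integral_multc) simp
    also have "\<dots> = ecount (edge_boundary V E {x \<in> V. t < f x}) * indicator {0..} t"
      by (subst ecount_eq_nn_integral[of _ E]) (auto simp: edge_boundary_def)
    finally show ?thesis ..
  qed
  interpret sigma_finite_measure "count_space E"
    using E by (rule sigma_finite_measure_count_space_countable)
  \<comment> \<open>As \<open>E\<close> is countable, joint measurability can be checked edge by
    edge; the pair is then swapped so that the edge is the variable integrated out.\<close>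
  have "(\<lambda>(e, t). indicator (S e) t :: ennreal) \<in> borel_measurable (count_space E \<Otimes>\<^sub>M lborel)"
    using E S by (intro measurable_pair_measure_countable1) (auto intro: borel_measurable_indicator)
  then have "(\<lambda>(t, e). indicator (S e) t :: ennreal) \<in> borel_measurable (lborel \<Otimes>\<^sub>M count_space E)"
    by (subst measurable_pair_swap_iff) simp
  from borel_measurable_nn_integral[OF this]
  show "(\<lambda>t. ecount (edge_boundary V E {x \<in> V. t < f x}) * indicator {0..} t)
      \<in> borel_measurable lborel"
    by (simp add: integrand)
  have "grad_L1 E f = (\<integral>\<^sup>+e. ennreal (edge_diff f e) \<partial>count_space E)"
    unfolding grad_L1_def using E by (rule infsum_ennreal_eq_nn_integral)
  also have "\<dots> = (\<integral>\<^sup>+e. \<integral>\<^sup>+t. indicator (S e) t \<partial>lborel \<partial>count_space E)"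
    using S by (intro nn_integral_cong) auto
  also have "\<dots> = (\<integral>\<^sup>+t. \<integral>\<^sup>+e. indicator (S e) t \<partial>count_space E \<partial>lborel)"
    using E S by (intro nn_integral_count_space_nn_integral[symmetric])
        (auto intro: borel_measurable_indicator)
  finally show "grad_L1 E f =
      (\<integral>\<^sup>+t. ecount (edge_boundary V E {x \<in> V. t < f x}) * indicator {0..} t \<partial>lborel)"
    by (simp add: integrand)
qed

text \<open>Used with the supremum norm as \<open>M\<close>: the length of this range of levels is
  what multiplies \<beta>. For infinite \<open>M\<close> the bound is trivial.\<close>

lemma emeasure_levels_below:
  "{t. 0 \<le> t \<and> ennreal t < M} \<in> sets lborel" "emeasure lborel {t. 0 \<le> t \<and> ennreal t < M} \<le> M"
proof -
  show "{t. 0 \<le> t \<and> ennreal t < M} \<in> sets lborel"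
    by measurable
  show "emeasure lborel {t. 0 \<le> t \<and> ennreal t < M} \<le> M"
  proof (cases M)
    case (real s)
    then have "{t. 0 \<le> t \<and> ennreal t < M} = {0..<s}"
      by (auto simp: ennreal_less_iff)
    with real show ?thesis by simp
  qed simp
qed

section \<open>Superlevel sets of the rearrangement\<close>

text \<open>Each direction uses one count in \<open>kth_largest\<close>: at least \<open>k\<close>
  vertices have values reaching \<open>y\<close>, and fewer than \<open>k\<close> have values
  exceeding it.\<close>

lemma kth_largest_greater_iff:
  assumes "kth_largest V f k y"
  shows "t < y \<longleftrightarrow> of_nat k \<le> ecount {x \<in> V. t < f x}"
proof
  assume "t < y"
  then have "ecount {x \<in> V. f x \<ge> y} \<le> ecount {x \<in> V. t < f x}"
    by (intro ecount_mono) auto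
  with assms show "of_nat k \<le> ecount {x \<in> V. t < f x}"
    unfolding kth_largest_def by (meson order_trans)
next
  assume *: "of_nat k \<le> ecount {x \<in> V. t < f x}"
  show "t < y"
  proof (rule ccontr)
    assume "\<not> t < y"
    then have "ecount {x \<in> V. t < f x} \<le> ecount {x \<in> V. f x > y}"
      by (intro ecount_mono) auto
    with * assms show False
      unfolding kth_largest_def by (meson order_trans leD)
  qed
qed

text \<open>Whether \<open>v k\<close> lies above level \<open>t\<close> depends only on comparing
  \<open>k\<close> with the size of {f > t}, so ties among values do no harm.\<close>

lemma superlevel_rearrangement:
  assumes v: "enumerates v V" and r: "is_rearrangement V v f f'"
  shows "{x \<in> V. t < f' x} =
    (if finite {x \<in> V. t < f x} then v ` {1..card {x \<in> V. t < f x}} else V)"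
proof -
  let ?A = "{x \<in> V. t < f x}"
  have V: "V = v ` positions V"
    using v by (simp add: enumerates_def bij_betw_def)
  have iff: "t < f' (v k) \<longleftrightarrow> infinite ?A \<or> k \<le> card ?A" if "k \<in> positions V" for k
  proof -
    have "kth_largest V f k (f' (v k))"
      using r that by (simp add: is_rearrangement_def)
    then show ?thesis
      unfolding of_nat_le_ecount_iff[symmetric] by (rule kth_largest_greater_iff)
  qed
  have "{x \<in> V. t < f' x} = v ` {k \<in> positions V. infinite ?A \<or> k \<le> card ?A}"
  proof -
    have "{x \<in> v ` positions V. t < f' x} = v ` {k \<in> positions V. infinite ?A \<or> k \<le> card ?A}"
      using iff by blast
    then show ?thesis
      by (simp only: V[symmetric])
  qed
  also have "\<dots> = (if finite ?A then v ` {1..card ?A} else V)"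
  proof (cases "finite ?A")
    case True
    \<comment> \<open>Ensures that 1, ..., \<open>card ?A\<close> are all positions when
      \<open>V\<close> is finite.\<close>
    have "card ?A \<le> card V" if "finite V"
      using that by (intro card_mono) auto
    then have "{k \<in> positions V. k \<le> card ?A} = {1..card ?A}"
      by (auto simp: positions_def)
    with True show ?thesis by simp
  next
    case False
    then show ?thesis
      by (simp add: V[symmetric])
  qed
  finally show ?thesis .
qed

text \<open>The \<open>if\<close> charges \<open>b\<close> only where {f > t} is nonempty, so that
  its integral over the levels stays within the range below the supremum.\<close>

lemma ecount_boundary_superlevel_rearrangement:
  assumes v: "enumerates v V" and r: "is_rearrangement V v f f'"
    and iso: "\<forall>N\<in>positions V. ecount (edge_boundary V E (v ` {1..N})) \<le>
             b + a * (INF A\<in>{A. A \<subseteq> V \<and> finite A \<and> card A = N}. ecount (edge_boundary V E A))"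
  shows "ecount (edge_boundary V E {x \<in> V. t < f' x}) \<le>
    (if {x \<in> V. t < f x} = {} then 0 else b) + a * ecount (edge_boundary V E {x \<in> V. t < f x})"
proof -
  let ?A = "{x \<in> V. t < f x}"
  have zero: "ecount (edge_boundary V E {}) = 0" "ecount (edge_boundary V E V) = 0"
    by (simp_all add: edge_boundary_def ecount_def)
  consider "infinite ?A" | "?A = {}" | "finite ?A" "?A \<noteq> {}"
    by blast
  then show ?thesis
  proof cases
    case 1
    then show ?thesis
      by (simp add: superlevel_rearrangement[OF v r] zero)
  next
    case 2
    then show ?thesis
      by (simp add: superlevel_rearrangement[OF v r] zero)
  next
    case 3
    have "card ?A \<le> card V" if "finite V"
      using that by (intro card_mono) auto
    \<comment> \<open>Positions start at 1, hence the separate case of an empty superlevel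
      set.\<close>
    with 3 have "card ?A \<in> positions V"
      by (auto simp: positions_def Suc_le_eq card_gt_0_iff)
    with iso have "ecount (edge_boundary V E (v ` {1..card ?A})) \<le>
        b + a * (INF A\<in>{A. A \<subseteq> V \<and> finite A \<and> card A = card ?A}. ecount (edge_boundary V E A))"
      by blast
    \<comment> \<open>{f > t} itself competes in the infimum.\<close>
    also have "\<dots> \<le> b + a * ecount (edge_boundary V E ?A)"
      using 3 by (intro add_left_mono mult_left_mono INF_lower) auto
    finally show ?thesis
      using 3 unfolding superlevel_rearrangement[OF v r] by auto
  qed
qed

section \<open>Integration over the levels\<close>

theorem theorem2:
  fixes V :: "'a set" and E :: "'a set set" and v :: "nat \<Rightarrow> 'a" and \<alpha> \<beta> :: real
  assumes "simple_graph V E"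
    and "enumerates v V"
    and "1 \<le> \<alpha>" and "0 \<le> \<beta>"
    and "\<forall>N\<in>positions V.
           ecount (edge_boundary V E (v ` {1..N})) \<le>
             ennreal \<beta> + ennreal \<alpha> *
               (INF A\<in>{A. A \<subseteq> V \<and> finite A \<and> card A = N}. ecount (edge_boundary V E A))"
  shows "\<forall>f f'. (\<forall>x\<in>V. 0 \<le> f x) \<longrightarrow> is_rearrangement V v f f' \<longrightarrow>
           grad_L1 E f' \<le> ennreal \<alpha> * grad_L1 E f + ennreal \<beta> * sup_norm V f"
proof (intro allI impI)
  fix f f' :: "'a \<Rightarrow> real"
  assume nonneg: "\<forall>x\<in>V. 0 \<le> f x" and r: "is_rearrangement V v f f'"
  have V: "V = v ` positions V"
    using assms(2) by (simp add: enumerates_def bij_betw_def)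
  then have cV: "countable V"
    by (metis countableI_type countable_image)
  \<comment> \<open>On \<open>V\<close>, values of \<open>f'\<close> are values of \<open>f\<close>,
    so the coarea formula applies to \<open>f'\<close> too.\<close>
  have nonneg': "\<forall>x\<in>V. 0 \<le> f' x"
  proof
    fix x assume "x \<in> V"
    with V obtain k where "k \<in> positions V" "x = v k" by blast
    with r have "f' x \<in> f ` V"
      by (auto simp: is_rearrangement_def kth_largest_def)
    with nonneg show "0 \<le> f' x" by auto
  qed
  \<comment> \<open>\<open>T\<close> contains every level t \<ge> 0 with {f > t} nonempty, so
    \<beta> is paid only on \<open>T\<close>.\<close>
  define T where "T = {t. 0 \<le> t \<and> ennreal t < sup_norm V f}"
  define \<phi> where "\<phi> t = ecount (edge_boundary V E {x \<in> V. t < f x}) * indicator {0..} t" for t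
  have T: "T \<in> sets lborel" "emeasure lborel T \<le> sup_norm V f"
    unfolding T_def by (rule emeasure_levels_below)+
  have \<phi>: "\<phi> \<in> borel_measurable lborel" "grad_L1 E f = (\<integral>\<^sup>+t. \<phi> t \<partial>lborel)"
    unfolding \<phi>_def using coarea[OF assms(1) cV nonneg] by auto
  have "grad_L1 E f' =
      (\<integral>\<^sup>+t. ecount (edge_boundary V E {x \<in> V. t < f' x}) * indicator {0..} t \<partial>lborel)"
    by (rule grad_L1_eq_nn_integral[OF assms(1) cV nonneg'])
  also have "\<dots> \<le> (\<integral>\<^sup>+t. ennreal \<alpha> * \<phi> t + ennreal \<beta> * indicator T t \<partial>lborel)"
  proof (rule nn_integral_mono)
    fix t :: real
    have T_mem: "t \<in> T" if t: "0 \<le> t" "{x \<in> V. t < f x} \<noteq> {}"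
    proof -
      obtain x where x: "x \<in> V" "t < f x"
        using t(2) by blast
      then have "ennreal t < ennreal \<bar>f x\<bar>"
        using t by (auto simp: ennreal_less_iff)
      also have "\<dots> \<le> sup_norm V f"
        unfolding sup_norm_def using x by (intro SUP_upper)
      finally show ?thesis
        using t by (simp add: T_def)
    qed
    have "ecount (edge_boundary V E {x \<in> V. t < f' x}) \<le>
        (if {x \<in> V. t < f x} = {} then 0 else ennreal \<beta>) +
        ennreal \<alpha> * ecount (edge_boundary V E {x \<in> V. t < f x})"
      by (rule ecount_boundary_superlevel_rearrangement[OF assms(2) r assms(5)])
    also have "\<dots> \<le> ennreal \<beta> * indicator T t +
        ennreal \<alpha> * ecount (edge_boundary V E {x \<in> V. t < f x})" if "0 \<le> t"
      using T_mem[OF that] by (intro add_right_mono) (auto split: split_indicator)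
    finally show "ecount (edge_boundary V E {x \<in> V. t < f' x}) * indicator {0..} t
        \<le> ennreal \<alpha> * \<phi> t + ennreal \<beta> * indicator T t"
      by (cases "0 \<le> t") (auto simp: \<phi>_def add.commute)
  qed
  \<comment> \<open>Measurability of \<open>\<phi>\<close> and \<open>T\<close> lets the integral
    split; coarea for \<open>f\<close> turns the first part back into its gradient norm.\<close>
  also have "\<dots> = ennreal \<alpha> * grad_L1 E f + ennreal \<beta> * emeasure lborel T"
    using T \<phi> by (simp add: nn_integral_add nn_integral_cmult)
  also have "\<dots> \<le> ennreal \<alpha> * grad_L1 E f + ennreal \<beta> * sup_norm V f"
    using T by (intro add_left_mono mult_left_mono) auto
  finally show "grad_L1 E f' \<le> ennreal \<alpha> * grad_L1 E f + ennreal \<beta> * sup_norm V f" .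
qed

end
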